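(* Let $n\in\mathbb{N}$. Let $\Omega_1\in\tau_s(\mathbb{H}_s^n)$ be real-path-connected, let $\Omega_2\in\tau_s(\mathbb{H}_s^n)$ be $\Omega_1$-stem-preserving, and let $f\in\mathcal{SR}(\Omega_2)$. Then $F_{\Omega_1}^f:\mathscr{P}(\mathbb{C}^n,\Omega_1)\to\mathbb{H}^{2\times1}$ is holomorphic in $\mathscr{P}(\mathbb{C}^n,\Omega_1)$.
   Context: $\mathbb{H}$ is the algebra of quaternions, $\mathbb{S}:=\{I\in\mathbb{H}: I^2=-1\}$, and for $I\in\mathbb{S}$, $\mathbb{C}_I:=\mathbb{R}+\mathbb{R}I$, $\mathbb{C}_I^n:=(\mathbb{C}_I)^n$. The weakly slice cone is $\mathbb{H}_s^n:=\bigcup_{I\in\mathbb{S}}\mathbb{C}_I^n\subset\mathbb{H}^n$. For $\Omega\subset\mathbb{H}_s^n$ put $\Omega_I:=\Omega\cap\mathbb{C}_I^n$. The slice topology $\tau_s(\mathbb{H}_s^n)$ consists of all $\Omega\subset\mathbb{H}_s^n$ such that $\Omega_I$ is open in $\mathbb{C}_I^n$ (Euclidean topology) for every $I\in\mathbb{S}$. For $z=x+yi\in\mathbb{C}^n$ ($x,y\in\mathbb{R}^n$) and $I\in\mathbb{S}$, $z^I:=x+yI\in\mathbb{C}_I^n$; for a path $\gamma:[0,1]\to\mathbb{C}^n$, $\gamma^I(t):=(\gamma(t))^I$. $\mathscr{P}(\mathbb{C}^n)$ is the set of continuous $\gamma:[0,1]\to\mathbb{C}^n$ with $\gamma(0)\in\mathbb{R}^n$.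 Writing $\gamma^I\subset\Omega$ for $\gamma^I([0,1])\subset\Omega$, set $\mathbb{S}(\Omega,\gamma):=\{I\in\mathbb{S}:\gamma^I\subset\Omega\}$ and $\mathscr{P}(\mathbb{C}^n,\Omega):=\{\gamma\in\mathscr{P}(\mathbb{C}^n):\mathbb{S}(\Omega,\gamma)\neq\varnothing\}$. $\Omega\subset\mathbb{H}_s^n$ is real-path-connected if for each $q\in\Omega$ there are $\gamma\in\mathscr{P}(\mathbb{C}^n,\Omega)$ and $I\in\mathbb{S}(\Omega,\gamma)$ with $\gamma^I(1)=q$. $\Omega_2\subset\mathbb{H}_s^n$ is $\Omega_1$-stem-preserving if (i) $|\mathbb{S}(\Omega_2,\gamma)|\geq 2$ for every $\gamma\in\mathscr{P}(\mathbb{C}^n,\Omega_1)$, and (ii) $|\mathbb{S}(\Omega_2,\alpha)\cap\mathbb{S}(\Omega_2,\beta)|\neq 1$ for all $\alpha,\beta\in\mathscr{P}(\mathbb{C}^n,\Omega_1)$ with $\alpha(1)=\beta(1)$. Slice regular functions: for $\Omega\in\tau_s(\mathbb{H}_s^n)$, $f:\Omega\to\mathbb{H}$ is (weakly) slice regular if for every $I\in\mathbb{S}$ the restriction $f_I:=f|_{\Omega_I}$ is real differentiable and $\frac12\left(\frac{\partial}{\partial x_\ell}+I\frac{\partial}{\partial y_\ell}\right)f_I(x+yI)=0$ on $\Omega_I$ for each $\ell=1,\dots,n$. The set of these is $\mathcal{SR}(\Omega)$. Path-slice functions: $f:\Omega\to\mathbb{H}$ ($\Omega\subset\mathbb{H}_s^n$)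 is path-slice if there is $F:\mathscr{P}(\mathbb{C}^n,\Omega)\to\mathbb{H}^{2\times1}$ (a path-slice stem function of $f$) with $f(\gamma^I(1))=(1,I)F(\gamma)$ for all $\gamma\in\mathscr{P}(\mathbb{C}^n,\Omega)$, $I\in\mathbb{S}(\Omega,\gamma)$. It is a known fact that every $f\in\mathcal{SR}(\Omega)$, $\Omega\in\tau_s(\mathbb{H}_s^n)$, is path-slice. If $\Omega_2$ is $\Omega_1$-stem-preserving with $\Omega_1$ real-path-connected and $f:\Omega_2\to\mathbb{H}$ is path-slice, then $F_{\Omega_1}^f:\mathscr{P}(\mathbb{C}^n,\Omega_1)\to\mathbb{H}^{2\times1}$ denotes $G|_{\mathscr{P}(\mathbb{C}^n,\Omega_1)}$ for any path-slice stem function $G$ of $f$ (known to be independent of $G$). Holomorphy on path spaces: for $z,w\in\mathbb{C}^n$ let $\mathcal{L}_z^w(t):=(1-t)z+tw$, $t\in[0,1]$. For $\gamma\in\mathscr{P}(\mathbb{C}^n)$ and $z\in\mathbb{C}^n$, $\mathscr{L}_\gamma(z):=\gamma\circ\mathcal{L}_{\gamma(1)}^z\in\mathscr{P}(\mathbb{C}^n)$, where $\circ$ denotes concatenation of paths (first $\gamma$, then the segment). For $r>0$, with $B_{\mathbb{C}^n}(\gamma(1),r)$ the Euclidean open ball, $B_{\mathscr{P}(\mathbb{C}^n)}(\gamma,r):=\{\mathscr{L}_\gamma(z):z\in B_{\mathbb{C}^n}(\gamma(1),r)\}$. Let $\sigma:=\begin{pmatrix}0&-1\\1&0\end{pmatrix}$,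 acting on $\mathbb{H}^{2\times1}$ by left multiplication. A function $F:\mathscr{P}(\mathbb{C}^n,\Omega)\to\mathbb{H}^{2\times1}$ is holomorphic at $\gamma$ if there is $r>0$ such that $B_{\mathscr{P}(\mathbb{C}^n)}(\gamma,r)\subset\mathscr{P}(\mathbb{C}^n,\Omega)$ and $\frac12\left(\frac{\partial}{\partial x_\ell}+\sigma\frac{\partial}{\partial y_\ell}\right)(F\circ\mathscr{L}_\gamma)(x+yi)=0$ for each $x+yi\in B_{\mathbb{C}^n}(\gamma(1),r)$ and $\ell\in\{1,\dots,n\}$. $F$ is holomorphic in $U\subset\mathscr{P}(\mathbb{C}^n,\Omega)$ if it is holomorphic at each $\gamma\in U$. *)

theory Defs
  imports "HOL-Analysis.Analysis"
begin

section \<open>The quaternions\<close>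

datatype quat = Quat (qRe: real) (qI: real) (qJ: real) (qK: real)

lemma quat_eq_iff: "x = y \<longleftrightarrow> qRe x = qRe y \<and> qI x = qI y \<and> qJ x = qJ y \<and> qK x = qK y"
  by (cases x; cases y) auto

instantiation quat :: real_algebra_1
begin

definition zero_quat :: quat where "0 = Quat 0 0 0 0"
definition one_quat :: quat where "1 = Quat 1 0 0 0"
definition plus_quat :: "quat \<Rightarrow> quat \<Rightarrow> quat" where
  "x + y = Quat (qRe x + qRe y) (qI x + qI y) (qJ x + qJ y) (qK x + qK y)"
definition minus_quat :: "quat \<Rightarrow> quat \<Rightarrow> quat" where
  "x - y = Quat (qRe x - qRe y) (qI x - qI y) (qJ x - qJ y) (qK x - qK y)"
definition uminus_quat :: "quat \<Rightarrow> quat" where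
  "- x = Quat (- qRe x) (- qI x) (- qJ x) (- qK x)"
definition times_quat :: "quat \<Rightarrow> quat \<Rightarrow> quat" where
  "x * y = Quat (qRe x * qRe y - qI x * qI y - qJ x * qJ y - qK x * qK y)
                (qRe x * qI y + qI x * qRe y + qJ x * qK y - qK x * qJ y)
                (qRe x * qJ y - qI x * qK y + qJ x * qRe y + qK x * qI y)
                (qRe x * qK y + qI x * qJ y - qJ x * qI y + qK x * qRe y)"
definition scaleR_quat :: "real \<Rightarrow> quat \<Rightarrow> quat" where
  "scaleR r x = Quat (r * qRe x) (r * qI x) (r * qJ x) (r * qK x)"

instance
  by standard
    (simp_all add: quat_eq_iff zero_quat_def one_quat_def plus_quat_def minus_quat_def
      uminus_quat_def times_quat_def scaleR_quat_def algebra_simps)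

end

lemma quat_sel_simps [simp]:
  "qRe 0 = 0" "qI 0 = 0" "qJ 0 = 0" "qK 0 = 0"
  "qRe 1 = 1" "qI 1 = 0" "qJ 1 = 0" "qK 1 = 0"
  "qRe (x + y) = qRe x + qRe y" "qI (x + y) = qI x + qI y"
  "qJ (x + y) = qJ x + qJ y" "qK (x + y) = qK x + qK y"
  "qRe (x - y) = qRe x - qRe y" "qI (x - y) = qI x - qI y"
  "qJ (x - y) = qJ x - qJ y" "qK (x - y) = qK x - qK y"
  "qRe (- x) = - qRe x" "qI (- x) = - qI x" "qJ (- x) = - qJ x" "qK (- x) = - qK x"
  "qRe (r *\<^sub>R x) = r * qRe x" "qI (r *\<^sub>R x) = r * qI x"
  "qJ (r *\<^sub>R x) = r * qJ x" "qK (r *\<^sub>R x) = r * qK x"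
  by (simp_all add: zero_quat_def one_quat_def plus_quat_def minus_quat_def
      uminus_quat_def scaleR_quat_def)

lemma quat_mult_sel:
  "qRe (x * y) = qRe x * qRe y - qI x * qI y - qJ x * qJ y - qK x * qK y"
  "qI (x * y) = qRe x * qI y + qI x * qRe y + qJ x * qK y - qK x * qJ y"
  "qJ (x * y) = qRe x * qJ y - qI x * qK y + qJ x * qRe y + qK x * qI y"
  "qK (x * y) = qRe x * qK y + qI x * qJ y - qJ x * qI y + qK x * qRe y"
  by (simp_all add: times_quat_def)

instantiation quat :: real_inner
begin

definition inner_quat :: "quat \<Rightarrow> quat \<Rightarrow> real" where
  "inner x y = qRe x * qRe y + qI x * qI y + qJ x * qJ y + qK x * qK y"
definition norm_quat :: "quat \<Rightarrow> real" where "norm x = sqrt (inner x x)" for x :: quat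
definition sgn_quat :: "quat \<Rightarrow> quat" where "sgn x = x /\<^sub>R norm x" for x :: quat
definition dist_quat :: "quat \<Rightarrow> quat \<Rightarrow> real" where "dist x y = norm (x - y)" for x y :: quat
definition uniformity_quat :: "(quat \<times> quat) filter" where
  "uniformity = (INF e\<in>{0<..}. principal {(x, y :: quat). dist x y < e})"
definition open_quat :: "quat set \<Rightarrow> bool" where
  "open U \<longleftrightarrow> (\<forall>x\<in>U. \<forall>\<^sub>F (x', y) in uniformity. x' = x \<longrightarrow> y \<in> U)" for U :: "quat set"

instance
proof
  fix x y z :: quat and r :: real
  show "dist x y = norm (x - y)" by (rule dist_quat_def)
  show "sgn x = x /\<^sub>R norm x" by (rule sgn_quat_def)
  show "(uniformity :: (quat \<times> quat) filter) = (INF e\<in>{0<..}. principal {(x, y). dist x y < e})"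
    by (rule uniformity_quat_def)
  show "open U \<longleftrightarrow> (\<forall>x\<in>U. \<forall>\<^sub>F (x', y) in uniformity. x' = x \<longrightarrow> y \<in> U)" for U :: "quat set"
    by (rule open_quat_def)
  show "inner x y = inner y x" by (simp add: inner_quat_def mult.commute)
  show "inner (x + y) z = inner x z + inner y z" by (simp add: inner_quat_def algebra_simps)
  show "inner (r *\<^sub>R x) y = r * inner x y" by (simp add: inner_quat_def algebra_simps)
  show "0 \<le> inner x x" by (simp add: inner_quat_def)
  show "inner x x = 0 \<longleftrightarrow> x = 0"
    by (simp add: inner_quat_def quat_eq_iff add_nonneg_eq_0_iff)
  show "norm x = sqrt (inner x x)" by (rule norm_quat_def)
qed

end

instantiation quat :: euclidean_space
begin

definition Basis_quat :: "quat set" where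
  "Basis = {Quat 1 0 0 0, Quat 0 1 0 0, Quat 0 0 1 0, Quat 0 0 0 1}"

instance
proof
  fix u v x :: quat
  show "(Basis :: quat set) \<noteq> {}" "finite (Basis :: quat set)"
    by (simp_all add: Basis_quat_def)
  show "inner u v = (if u = v then 1 else 0)" if "u \<in> Basis" "v \<in> Basis"
    using that unfolding Basis_quat_def by (elim insertE emptyE) (simp_all add: inner_quat_def)
  show "(\<forall>u\<in>Basis. inner x u = 0) \<longleftrightarrow> x = 0"
    unfolding quat_eq_iff by (simp add: Basis_quat_def inner_quat_def)
qed

end

instantiation quat :: real_normed_div_algebra
begin

definition inverse_quat :: "quat \<Rightarrow> quat" where
  "inverse x = Quat (qRe x) (- qI x) (- qJ x) (- qK x) /\<^sub>R inner x x"
definition divide_quat :: "quat \<Rightarrow> quat \<Rightarrow> quat" where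
  "x div y = x * inverse y" for x y :: quat

instance
proof
  fix x y :: quat
  show "norm (x * y) = norm x * norm y"
    unfolding norm_quat_def real_sqrt_mult[symmetric]
    by (rule arg_cong[where f = sqrt]) (simp add: inner_quat_def quat_mult_sel algebra_simps)
  show "x div y = x * inverse y" by (rule divide_quat_def)
  show "inverse (0::quat) = 0" by (simp add: inverse_quat_def)
  assume "x \<noteq> 0"
  then have N: "inner x x \<noteq> 0" by simp
  let ?c = "Quat (qRe x) (- qI x) (- qJ x) (- qK x)"
  have "?c * x = inner x x *\<^sub>R 1" "x * ?c = inner x x *\<^sub>R 1"
    by (simp_all add: quat_eq_iff quat_mult_sel inner_quat_def)
  then show "inverse x * x = 1" "x * inverse x = 1"
    using N by (simp_all add: inverse_quat_def)
qed

end


section \<open>The weakly slice cone and the slice topology\<close>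

definition sphere_units :: "quat set" where
  "sphere_units = {I. I\<^sup>2 = - 1}"

definition slice_plane :: "quat \<Rightarrow> quat set" where
  "slice_plane I = {of_real x + of_real y * I |x y. True}"

definition slice_space :: "quat \<Rightarrow> (quat^'n) set" where
  "slice_space I = {q. \<forall>l. q $ l \<in> slice_plane I}"

definition slice_cone :: "(quat^'n) set" where
  "slice_cone = (\<Union>I\<in>sphere_units. slice_space I)"

definition slice_topology :: "(quat^'n) topology" where
  "slice_topology = topology (\<lambda>\<Omega>. \<Omega> \<subseteq> slice_cone \<and>
     (\<forall>I\<in>sphere_units. openin (top_of_set (slice_space I)) (\<Omega> \<inter> slice_space I)))"

lemma openin_slice_topology:
  fixes \<Omega> :: "(quat^'n) set"
  shows "openin slice_topology \<Omega> \<longleftrightarrow> \<Omega> \<subseteq> slice_cone \<and>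
     (\<forall>I\<in>sphere_units. openin (top_of_set (slice_space I)) (\<Omega> \<inter> slice_space I))"
proof -
  let ?P = "\<lambda>\<Omega> :: (quat^'n) set. \<Omega> \<subseteq> slice_cone \<and>
     (\<forall>I\<in>sphere_units. openin (top_of_set (slice_space I)) (\<Omega> \<inter> slice_space I))"
  have "istopology ?P"
    unfolding istopology_def
  proof (intro conjI allI impI)
    fix S T :: "(quat^'n) set" assume S: "?P S" and T: "?P T"
    show "S \<inter> T \<subseteq> slice_cone" using S by blast
    show "\<forall>I\<in>sphere_units. openin (top_of_set (slice_space I)) (S \<inter> T \<inter> slice_space I)"
    proof
      fix I assume "I \<in> sphere_units"
      then have "openin (top_of_set (slice_space I)) ((S \<inter> slice_space I) \<inter> (T \<inter> slice_space I))"
        using S T by blast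
      then show "openin (top_of_set (slice_space I)) (S \<inter> T \<inter> slice_space I)"
        by (simp add: Int_ac)
    qed
  next
    fix \<K> :: "(quat^'n) set set" assume K: "\<forall>S\<in>\<K>. ?P S"
    show "\<Union>\<K> \<subseteq> slice_cone" using K by blast
    show "\<forall>I\<in>sphere_units. openin (top_of_set (slice_space I)) (\<Union>\<K> \<inter> slice_space I)"
    proof
      fix I assume "I \<in> sphere_units"
      then have "openin (top_of_set (slice_space I)) (\<Union>S\<in>\<K>. S \<inter> slice_space I)"
        using K by (intro openin_Union) auto
      then show "openin (top_of_set (slice_space I)) (\<Union>\<K> \<inter> slice_space I)"
        by (simp only: Int_Union2)
    qed
  qed
  then show ?thesis
    unfolding slice_topology_def by (simp add: topology_inverse')
qed


section \<open>Paths and stem-preserving sets\<close>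

definition lift_point :: "quat \<Rightarrow> complex^'n \<Rightarrow> quat^'n" where
  "lift_point I z = (\<chi> l. of_real (Re (z $ l)) + of_real (Im (z $ l)) * I)"

text \<open>Paths are functions on the unit interval: they are extensional on \<open>{0..1}\<close>, so that
  equality of paths is equality of their values on \<open>{0..1}\<close>.\<close>

definition real_paths :: "(real \<Rightarrow> complex^'n) set" where
  "real_paths = {\<gamma> \<in> extensional {0..1}. path \<gamma> \<and> (\<forall>l. pathstart \<gamma> $ l \<in> \<real>)}"

definition unit_set :: "(quat^'n) set \<Rightarrow> (real \<Rightarrow> complex^'n) \<Rightarrow> quat set" where
  "unit_set \<Omega> \<gamma> = {I \<in> sphere_units. (\<lambda>t. lift_point I (\<gamma> t)) ` {0..1} \<subseteq> \<Omega>}"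

definition paths_in :: "(quat^'n) set \<Rightarrow> (real \<Rightarrow> complex^'n) set" where
  "paths_in \<Omega> = {\<gamma> \<in> real_paths. unit_set \<Omega> \<gamma> \<noteq> {}}"

definition real_path_connected :: "(quat^'n) set \<Rightarrow> bool" where
  "real_path_connected \<Omega> \<longleftrightarrow> \<Omega> \<subseteq> slice_cone \<and>
     (\<forall>q\<in>\<Omega>. \<exists>\<gamma>\<in>paths_in \<Omega>. \<exists>I\<in>unit_set \<Omega> \<gamma>. lift_point I (pathfinish \<gamma>) = q)"

text \<open>Since \<open>card\<close> is \<open>0\<close> on infinite sets, ``at least two elements'' needs the explicit infinite
  case, whereas \<open>card A \<noteq> 1\<close> already says that \<open>A\<close> is not a singleton.\<close>

definition stem_preserving :: "(quat^'n) set \<Rightarrow> (quat^'n) set \<Rightarrow> bool" where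
  "stem_preserving \<Omega>\<^sub>1 \<Omega>\<^sub>2 \<longleftrightarrow> \<Omega>\<^sub>2 \<subseteq> slice_cone \<and>
     (\<forall>\<gamma>\<in>paths_in \<Omega>\<^sub>1. infinite (unit_set \<Omega>\<^sub>2 \<gamma>) \<or> 2 \<le> card (unit_set \<Omega>\<^sub>2 \<gamma>)) \<and>
     (\<forall>\<alpha>\<in>paths_in \<Omega>\<^sub>1. \<forall>\<beta>\<in>paths_in \<Omega>\<^sub>1. pathfinish \<alpha> = pathfinish \<beta> \<longrightarrow>
        card (unit_set \<Omega>\<^sub>2 \<alpha> \<inter> unit_set \<Omega>\<^sub>2 \<beta>) \<noteq> 1)"


section \<open>Slice regular functions\<close>

definition has_partial_x :: "(complex^'n \<Rightarrow> 'b::real_normed_vector) \<Rightarrow> 'n \<Rightarrow> complex^'n \<Rightarrow> 'b \<Rightarrow> bool"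
  where "has_partial_x g l z D \<longleftrightarrow>
    ((\<lambda>t. g (z + axis l (complex_of_real t))) has_vector_derivative D) (at 0)"

definition has_partial_y :: "(complex^'n \<Rightarrow> 'b::real_normed_vector) \<Rightarrow> 'n \<Rightarrow> complex^'n \<Rightarrow> 'b \<Rightarrow> bool"
  where "has_partial_y g l z D \<longleftrightarrow>
    ((\<lambda>t. g (z + axis l (complex_of_real t * \<i>))) has_vector_derivative D) (at 0)"

text \<open>The Cauchy--Riemann equations in all variables, with \<open>J\<close> in the role of the imaginary unit;
  existence of the partial derivatives is part of the condition.\<close>

definition cauchy_riemann_at ::
    "('b \<Rightarrow> 'b) \<Rightarrow> (complex^'n \<Rightarrow> 'b::real_normed_vector) \<Rightarrow> complex^'n \<Rightarrow> bool" where
  "cauchy_riemann_at J g z \<longleftrightarrow>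
     (\<forall>l. \<exists>Dx Dy. has_partial_x g l z Dx \<and> has_partial_y g l z Dy \<and>
        (1 / 2) *\<^sub>R (Dx + J Dy) = 0)"

text \<open>A function on \<open>\<Omega>\<close> is a total function of which only the values on \<open>\<Omega>\<close> matter.\<close>

definition slice_regular :: "(quat^'n) set \<Rightarrow> (quat^'n \<Rightarrow> quat) \<Rightarrow> bool" where
  "slice_regular \<Omega> f \<longleftrightarrow>
     (\<forall>I\<in>sphere_units. f differentiable_on (\<Omega> \<inter> slice_space I) \<and>
        (\<forall>z. lift_point I z \<in> \<Omega> \<longrightarrow> cauchy_riemann_at ((*) I) (\<lambda>w. f (lift_point I w)) z))"


section \<open>Path-slice stem functions and holomorphy on path spaces\<close>

definition path_slice_stem ::
    "(quat^'n) set \<Rightarrow> (quat^'n \<Rightarrow> quat) \<Rightarrow> ((real \<Rightarrow> complex^'n) \<Rightarrow> quat^2) \<Rightarrow> bool" where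
  "path_slice_stem \<Omega> f F \<longleftrightarrow>
     (\<forall>\<gamma>\<in>paths_in \<Omega>. \<forall>I\<in>unit_set \<Omega> \<gamma>.
        f (lift_point I (pathfinish \<gamma>)) = F \<gamma> $ 1 + I * F \<gamma> $ 2)"

text \<open>The common restriction to \<open>paths_in \<Omega>\<^sub>1\<close> of all path-slice stem functions of
  \<open>f\<close> on \<open>\<Omega>\<^sub>2\<close>; the description is proper because such a function exists and its values on
  \<open>paths_in \<Omega>\<^sub>1\<close> are determined by \<open>f\<close> when \<open>\<Omega>\<^sub>2\<close> is \<open>\<Omega>\<^sub>1\<close>-stem-preserving and \<open>f\<close> is
  path-slice.\<close>

definition stem_function ::
    "(quat^'n) set \<Rightarrow> (quat^'n) set \<Rightarrow> (quat^'n \<Rightarrow> quat) \<Rightarrow> (real \<Rightarrow> complex^'n) \<Rightarrow> quat^2" where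
  "stem_function \<Omega>\<^sub>1 \<Omega>\<^sub>2 f =
     (THE H. \<exists>G. path_slice_stem \<Omega>\<^sub>2 f G \<and> H = restrict G (paths_in \<Omega>\<^sub>1))"

definition path_extend :: "(real \<Rightarrow> complex^'n) \<Rightarrow> complex^'n \<Rightarrow> real \<Rightarrow> complex^'n" where
  "path_extend \<gamma> z = restrict (\<gamma> +++ linepath (pathfinish \<gamma>) z) {0..1}"

definition path_ball :: "(real \<Rightarrow> complex^'n) \<Rightarrow> real \<Rightarrow> (real \<Rightarrow> complex^'n) set" where
  "path_ball \<gamma> r = path_extend \<gamma> ` ball (pathfinish \<gamma>) r"

definition sigma_mat :: "quat^2^2" where
  "sigma_mat = vector [vector [0, - 1], vector [1, 0]]"

definition path_holomorphic_at ::
    "(quat^'n) set \<Rightarrow> ((real \<Rightarrow> complex^'n) \<Rightarrow> quat^2) \<Rightarrow> (real \<Rightarrow> complex^'n) \<Rightarrow> bool" where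
  "path_holomorphic_at \<Omega> F \<gamma> \<longleftrightarrow>
     (\<exists>r>0. path_ball \<gamma> r \<subseteq> paths_in \<Omega> \<and>
        (\<forall>z\<in>ball (pathfinish \<gamma>) r. cauchy_riemann_at ((*v) sigma_mat) (F \<circ> path_extend \<gamma>) z))"

definition path_holomorphic_on ::
    "(quat^'n) set \<Rightarrow> ((real \<Rightarrow> complex^'n) \<Rightarrow> quat^2) \<Rightarrow> (real \<Rightarrow> complex^'n) set \<Rightarrow> bool" where
  "path_holomorphic_on \<Omega> F U \<longleftrightarrow> U \<subseteq> paths_in \<Omega> \<and> (\<forall>\<gamma>\<in>U. path_holomorphic_at \<Omega> F \<gamma>)"

end

theory Submission
  imports Defs "HOL-Complex_Analysis.Conformal_Mappings"
begin

text \<open>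
  Fix two distinct imaginary units \<open>J\<close> and \<open>K\<close>. An affine map \<open>I \<mapsto> a + I b\<close> on the imaginary
  units is determined by its values at \<open>J\<close> and \<open>K\<close>, and \<open>a\<close>, \<open>b\<close> are real linear functions of those
  two values (\<open>stem_fst\<close>, \<open>stem_snd\<close>). Everything rests on the following transfer principle
  (\<open>stem_interpolation_derivative\<close>): if the two values are functions of \<open>z\<close> that are holomorphic
  with respect to left multiplication by \<open>J\<close> and by \<open>K\<close>, then \<open>(a, b)\<close> is holomorphic with respect
  to \<open>\<sigma>\<close>. The principle is used twice.

  Existence of a stem function. Let \<open>\<gamma>\<^sup>I\<close>, \<open>\<gamma>\<^sup>J\<close>, \<open>\<gamma>\<^sup>K\<close> run in the domain of \<open>f\<close>, and let \<open>a\<close>, \<open>b\<close>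
  interpolate \<open>f (z\<^sup>J)\<close> and \<open>f (z\<^sup>K)\<close>. By the transfer principle \<open>f (z\<^sup>I) - (a z + I b z)\<close> is
  holomorphic with respect to \<open>I\<close> near the trace of \<open>\<gamma>\<close>. At real points \<open>z\<^sup>I = z\<^sup>J = z\<^sup>K\<close>, so there
  it vanishes. Hence it vanishes near the real starting point of \<open>\<gamma>\<close>, and by continuation along
  \<open>\<gamma>\<close> also at the end point. The identity theorem needed here
  (\<open>left_holomorphic_vanishes_along_path\<close>) reduces to one complex variable by restricting to
  complex lines and composing with complex functionals on the quaternions.

  Holomorphy. A path \<open>\<gamma>\<close> in the first domain has two units \<open>J \<noteq> K\<close> along which it lifts to the
  second one, and this remains true, with the same \<open>J\<close> and \<open>K\<close>, when a short segment to \<open>z\<close> is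
  appended. So the stem function at the extended path is the interpolation of \<open>f (z\<^sup>J)\<close>
  and \<open>f (z\<^sup>K)\<close>, which satisfies the Cauchy--Riemann equations for \<open>\<sigma>\<close> by the transfer principle.
\<close>

section \<open>Functions holomorphic for left multiplication by a unit\<close>

text \<open>The Frechet form of the Cauchy--Riemann equations: the real derivative is complex linear when
  \<open>\<i>\<close> acts on the quaternions as left multiplication by \<open>I\<close>. Unlike the partial
  derivatives, it can be restricted to an arbitrary complex line.\<close>

definition left_holomorphic_on :: "quat \<Rightarrow> (complex^'n \<Rightarrow> quat) \<Rightarrow> (complex^'n) set \<Rightarrow> bool" where
  "left_holomorphic_on I g U \<longleftrightarrow>
     (\<forall>z\<in>U. \<exists>D. (g has_derivative D) (at z) \<and> (\<forall>v. D (\<i> *s v) = I * D v))"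

lemma left_holomorphic_on_subset:
  "left_holomorphic_on I g U \<Longrightarrow> V \<subseteq> U \<Longrightarrow> left_holomorphic_on I g V"
  unfolding left_holomorphic_on_def by blast

lemma unit_square: "I \<in> sphere_units \<Longrightarrow> I * I = - 1"
  by (simp add: sphere_units_def power2_eq_square)

lemma unit_square_mult: "I \<in> sphere_units \<Longrightarrow> I * (I * q) = - q"
  by (simp add: unit_square mult.assoc[symmetric])

lemma axis_scaleR_real: "axis l (complex_of_real t * c) = t *\<^sub>R (axis l c :: complex^'n)"
  by (auto simp: vec_eq_iff axis_def complex_eq_iff)

lemma has_derivative_imp_directional:
  assumes "(g has_derivative D) (at z)"
  shows "((\<lambda>t. g (z + t *\<^sub>R v)) has_vector_derivative D v) (at (0::real))"
proof -
  have "((\<lambda>t::real. z + t *\<^sub>R v) has_derivative (\<lambda>t. t *\<^sub>R v)) (at 0)"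
    by (auto intro!: derivative_eq_intros)
  moreover have "(g has_derivative D) (at (z + (0::real) *\<^sub>R v))"
    using assms by simp
  ultimately have "((\<lambda>t. g (z + t *\<^sub>R v)) has_derivative (\<lambda>t. D (t *\<^sub>R v))) (at 0)"
    using has_derivative_compose by blast
  moreover have "(\<lambda>t. D (t *\<^sub>R v)) = (\<lambda>t. t *\<^sub>R D v)"
    using has_derivative_linear[OF assms] by (simp add: linear_cmul)
  ultimately show ?thesis
    by (simp add: has_vector_derivative_def)
qed

lemma has_derivative_imp_partials:
  fixes g :: "complex^'n \<Rightarrow> 'b::real_normed_vector"
  assumes "(g has_derivative D) (at z)"
  shows "has_partial_x g l z (D (axis l 1))" "has_partial_y g l z (D (axis l \<i>))"
  using has_derivative_imp_directional[OF assms, of "axis l 1"]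
    has_derivative_imp_directional[OF assms, of "axis l \<i>"]
  unfolding has_partial_x_def has_partial_y_def
  by (simp_all add: axis_scaleR_real axis_scaleR_real[where c = 1, simplified])

text \<open>The Cauchy--Riemann equations speak of the coordinate vectors only; complex linearity in all
  directions follows since these vectors span over the complex numbers.\<close>

lemma cauchy_riemann_derivative_linear:
  fixes g :: "complex^'n \<Rightarrow> quat"
  assumes I: "I \<in> sphere_units" and D: "(g has_derivative D) (at z)"
    and CR: "cauchy_riemann_at ((*) I) g z"
  shows "D (\<i> *s v) = I * D v"
proof -
  have lin: "linear D"
    using D by (rule has_derivative_linear)
  have axis_i: "D (axis l \<i>) = I * D (axis l 1)" for l
  proof -
    obtain Dx Dy where "has_partial_x g l z Dx" "has_partial_y g l z Dy"
      and eq: "(1 / 2) *\<^sub>R (Dx + I * Dy) = 0"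
      using CR unfolding cauchy_riemann_at_def by blast
    then have "Dx = D (axis l 1)" "Dy = D (axis l \<i>)"
      using has_derivative_imp_partials[OF D, of l] vector_derivative_unique_at
      unfolding has_partial_x_def has_partial_y_def by blast+
    then have "D (axis l 1) + I * D (axis l \<i>) = 0"
      using eq by simp
    then have "I * (D (axis l 1) + I * D (axis l \<i>)) = 0"
      by simp
    then show ?thesis
      using unit_square_mult[OF I] by (simp add: distrib_left)
  qed
  have axis: "D (axis l c) = Re c *\<^sub>R D (axis l 1) + Im c *\<^sub>R (I * D (axis l 1))" for l c
  proof -
    have "axis l c = Re c *\<^sub>R axis l 1 + Im c *\<^sub>R (axis l \<i> :: complex^'n)"
      by (auto simp: vec_eq_iff axis_def complex_eq_iff)
    then show ?thesis
      using lin by (simp add: linear_add linear_cmul axis_i)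
  qed
  have decomp: "w = (\<Sum>l\<in>UNIV. axis l (w $ l))" for w :: "complex^'n"
    by (auto simp: vec_eq_iff axis_def if_distrib cong: if_cong)
  have "D (\<i> *s v) = (\<Sum>l\<in>UNIV. D (axis l (\<i> * v $ l)))"
    using lin by (subst decomp) (simp add: linear_sum)
  also have "\<dots> = (\<Sum>l\<in>UNIV. I * D (axis l (v $ l)))"
    by (intro sum.cong refl) (simp add: axis[of _ "_ * _"] axis[of _ "v $ _"] distrib_left
        unit_square_mult[OF I])
  also have "\<dots> = I * D (\<Sum>l\<in>UNIV. axis l (v $ l))"
    using lin by (simp add: linear_sum sum_distrib_left)
  finally show ?thesis
    using decomp[of v] by simp
qed

section \<open>The identity theorem\<close>

text \<open>These functionals intertwine left multiplication by \<open>I\<close> with multiplication by \<open>\<i>\<close>, and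
  together they separate points, since the real part is the inner product with \<open>e\<close>. They turn
  quaternion-valued holomorphic functions into scalar ones.\<close>

definition complex_functional :: "quat \<Rightarrow> quat \<Rightarrow> quat \<Rightarrow> complex" where
  "complex_functional I e q = Complex (inner q e) (- inner (I * q) e)"

lemma bounded_linear_complex_functional: "bounded_linear (complex_functional I e)"
  by (intro linear_conv_bounded_linear[THEN iffD1] linearI)
    (simp_all add: complex_functional_def complex_eq_iff inner_add_left distrib_left)

lemma complex_functional_unit_mult:
  "I \<in> sphere_units \<Longrightarrow> complex_functional I e (I * q) = \<i> * complex_functional I e q"
  by (simp add: complex_functional_def complex_eq_iff unit_square_mult)

lemma eq_zero_if_complex_functional_zero:
  assumes "\<And>e. complex_functional I e q = 0"
  shows "q = 0"
  using assms[of q] by (simp add: complex_functional_def complex_eq_iff)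

lemma has_derivative_complex_line:
  "((\<lambda>\<zeta>::complex. p + \<zeta> *s w) has_derivative (\<lambda>\<zeta>. \<zeta> *s w)) (at \<zeta>0)"
  for p w :: "complex^'n"
proof -
  have "linear (\<lambda>\<zeta>::complex. \<zeta> *s w)"
    by (rule linearI) (auto simp: vec_eq_iff distrib_right)
  then have "bounded_linear (\<lambda>\<zeta>::complex. \<zeta> *s w)"
    by (simp add: linear_conv_bounded_linear)
  then show ?thesis
    by (auto intro!: derivative_eq_intros bounded_linear_imp_has_derivative)
qed

lemma open_vimage_complex_line:
  fixes p w :: "complex^'n"
  assumes "open U"
  shows "open ((\<lambda>\<zeta>::complex. p + \<zeta> *s w) -` U)"
  using assms has_derivative_continuous[OF has_derivative_complex_line]
  by (intro continuous_open_vimage) auto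

text \<open>The one-variable identity theorem on the slice of a convex set by a complex line.\<close>

lemma left_holomorphic_vanishes_on_line:
  fixes g :: "complex^'n \<Rightarrow> quat" and p w :: "complex^'n"
  assumes I: "I \<in> sphere_units" and U: "open U" "convex U" and g: "left_holomorphic_on I g U"
    and p: "p \<in> U" and \<zeta>: "p + \<zeta> *s w \<in> U"
    and zero: "\<And>t::real. p + of_real t *s w \<in> U \<Longrightarrow> \<bar>t\<bar> < \<epsilon> \<Longrightarrow> g (p + of_real t *s w) = 0"
    and "\<epsilon> > 0"
  shows "g (p + \<zeta> *s w) = 0"
proof (rule eq_zero_if_complex_functional_zero[of I])
  fix e
  define L where "L = (\<lambda>\<zeta>. p + \<zeta> *s w)"
  define S where "S = L -` U"
  define h where "h = (\<lambda>\<zeta>. complex_functional I e (g (L \<zeta>)))"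
  interpret cf: bounded_linear "complex_functional I e"
    by (rule bounded_linear_complex_functional)
  have "open S"
    unfolding S_def L_def by (rule open_vimage_complex_line[OF U(1)])
  have "convex S"
    unfolding convex_def
  proof (intro ballI allI impI)
    fix x y u v assume *: "x \<in> S" "y \<in> S" "0 \<le> u" "0 \<le> v" "u + v = (1::real)"
    have "u *\<^sub>R L x + v *\<^sub>R L y \<in> U"
      using * U(2) unfolding S_def convex_def by auto
    moreover have "u *\<^sub>R L x + v *\<^sub>R L y = (u + v) *\<^sub>R p + (u *\<^sub>R x + v *\<^sub>R y) *s w"
      unfolding L_def by (auto simp: vec_eq_iff algebra_simps)
    ultimately show "u *\<^sub>R x + v *\<^sub>R y \<in> S"
      using * by (simp add: S_def L_def)
  qed
  have hol: "h holomorphic_on S"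
  proof (subst holomorphic_on_open[OF \<open>open S\<close>], intro ballI)
    fix x assume "x \<in> S"
    then obtain D where D: "(g has_derivative D) (at (L x))" and Di: "\<And>v. D (\<i> *s v) = I * D v"
      using g unfolding left_holomorphic_on_def S_def by blast
    have lin: "linear D"
      using D by (rule has_derivative_linear)
    have "((\<lambda>\<zeta>. g (L \<zeta>)) has_derivative (\<lambda>\<zeta>. D (\<zeta> *s w))) (at x)"
      using has_derivative_compose[OF has_derivative_complex_line[of p w x], of g D] D
      by (simp add: L_def)
    then have "(h has_derivative (\<lambda>\<zeta>. complex_functional I e (D (\<zeta> *s w)))) (at x)"
      unfolding h_def by (rule cf.has_derivative)
    moreover have "complex_functional I e (D (\<zeta> *s w)) = complex_functional I e (D w) * \<zeta>" for \<zeta>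
    proof -
      have "\<zeta> *s w = Re \<zeta> *\<^sub>R w + Im \<zeta> *\<^sub>R (\<i> *s w)"
        by (auto simp: vec_eq_iff complex_eq_iff)
      then have "D (\<zeta> *s w) = Re \<zeta> *\<^sub>R D w + Im \<zeta> *\<^sub>R (I * D w)"
        using lin by (simp add: linear_add linear_cmul Di)
      then show ?thesis
        by (simp add: cf.add cf.scaleR complex_functional_unit_mult[OF I] complex_eq_iff)
    qed
    ultimately have "(h has_field_derivative complex_functional I e (D w)) (at x)"
      by (simp add: has_field_derivative_def)
    then show "\<exists>f'. (h has_field_derivative f') (at x)" ..
  qed
  have "0 \<in> S" "\<zeta> \<in> S"
    using p \<zeta> by (simp_all add: S_def L_def)
  define R where "R = {x \<in> S. h x = 0}"
  have "0 islimpt R"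
  proof (subst islimpt_approachable, intro allI impI)
    fix d :: real assume "d > 0"
    obtain \<delta> where \<delta>: "\<delta> > 0" "ball 0 \<delta> \<subseteq> S"
      using \<open>open S\<close> \<open>0 \<in> S\<close> openE by blast
    define t where "t = min (min d \<delta>) \<epsilon> / 2"
    have t: "0 < t" "t < d" "t < \<delta>" "t < \<epsilon>"
      using \<open>d > 0\<close> \<delta> \<open>\<epsilon> > 0\<close> by (auto simp: t_def)
    have "of_real t \<in> S"
      using t \<delta> by (auto simp: subset_eq dist_norm)
    moreover from this have "h (of_real t) = 0"
      using zero[of t] t by (simp add: h_def S_def L_def cf.zero)
    ultimately show "\<exists>x'\<in>R. x' \<noteq> 0 \<and> dist x' 0 < d"
      using t by (intro bexI[of _ "of_real t"]) (auto simp: R_def)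
  qed
  have "h \<zeta> = 0"
  proof (rule analytic_continuation[OF hol \<open>open S\<close> _ _ \<open>0 \<in> S\<close> \<open>0 islimpt R\<close> _ \<open>\<zeta> \<in> S\<close>])
    show "connected S"
      using \<open>convex S\<close> by (rule convex_connected)
  qed (auto simp: R_def)
  then show "complex_functional I e (g (p + \<zeta> *s w)) = 0"
    by (simp add: h_def L_def)
qed

text \<open>The real points form a set of uniqueness: \<open>x + \<i>y\<close> lies on the complex line \<open>\<zeta> \<mapsto> x + \<zeta>y\<close>,
  whose points with real parameter are real.\<close>

lemma left_holomorphic_vanishes_on_ball_if_on_reals:
  fixes g :: "complex^'n \<Rightarrow> quat"
  assumes I: "I \<in> sphere_units" and g: "left_holomorphic_on I g (ball x0 r)"
    and x0: "\<forall>l. x0 $ l \<in> \<real>"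
    and zero: "\<And>x. x \<in> ball x0 r \<Longrightarrow> \<forall>l. x $ l \<in> \<real> \<Longrightarrow> g x = 0"
    and z: "z \<in> ball x0 r"
  shows "g z = 0"
proof -
  define x y :: "complex^'n" where "x = (\<chi> l. of_real (Re (z $ l)))" and "y = (\<chi> l. of_real (Im (z $ l)))"
  have z_eq: "z = x + \<i> *s y"
    by (simp add: x_def y_def vec_eq_iff complex_eq_iff)
  have "norm ((x0 - x) $ l) \<le> norm ((x0 - z) $ l)" for l
    using x0[rule_format, of l] abs_Re_le_cmod[of "x0 $ l - z $ l"]
    by (auto simp: x_def Reals_def simp flip: of_real_diff)
  then have "norm (x0 - x) \<le> norm (x0 - z)"
    by (rule norm_le_componentwise_cart)
  then have "x \<in> ball x0 r"
    using z by (simp add: dist_norm)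
  moreover have "g (x + of_real t *s y) = 0" if "x + of_real t *s y \<in> ball x0 r" for t
    using zero[OF that] by (simp add: x_def y_def)
  ultimately show ?thesis
    using left_holomorphic_vanishes_on_line[OF I _ _ g, of x \<i> y 1] z by (simp add: z_eq)
qed

lemma left_holomorphic_vanishes_on_ball_if_near_point:
  fixes g :: "complex^'n \<Rightarrow> quat"
  assumes I: "I \<in> sphere_units" and g: "left_holomorphic_on I g (ball c r)"
    and p: "p \<in> ball c r" and V: "open V" "p \<in> V" and zero: "\<And>x. x \<in> V \<Longrightarrow> g x = 0"
    and z: "z \<in> ball c r"
  shows "g z = 0"
proof -
  define w where "w = z - p"
  have "open ((\<lambda>\<zeta>::complex. p + \<zeta> *s w) -` V)"
    using V(1) by (rule open_vimage_complex_line)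
  moreover have "0 \<in> (\<lambda>\<zeta>::complex. p + \<zeta> *s w) -` V"
    using V(2) by simp
  ultimately obtain \<epsilon> where \<epsilon>: "\<epsilon> > 0" "ball 0 \<epsilon> \<subseteq> (\<lambda>\<zeta>::complex. p + \<zeta> *s w) -` V"
    using openE by blast
  have "g (p + of_real t *s w) = 0" if "\<bar>t\<bar> < \<epsilon>" for t
  proof (rule zero)
    have "of_real t \<in> ball (0::complex) \<epsilon>"
      using that by (simp add: dist_norm)
    then show "p + of_real t *s w \<in> V"
      using \<epsilon>(2) by blast
  qed
  moreover have "p + 1 *s w = z"
    by (simp add: w_def)
  ultimately show ?thesis
    using left_holomorphic_vanishes_on_line[OF I open_ball convex_ball g p, of 1 w \<epsilon>] z \<epsilon>(1)
    by simp
qed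

text \<open>The points near which \<open>g\<close> vanishes identically form an open set; it is also relatively closed
  by the preceding lemma, so it contains every connected set that it meets.\<close>

lemma left_holomorphic_vanishes_along_path:
  fixes g :: "complex^'n \<Rightarrow> quat" and \<gamma> :: "real \<Rightarrow> complex^'n"
  assumes I: "I \<in> sphere_units" and U: "open U" and g: "left_holomorphic_on I g U"
    and \<gamma>: "path \<gamma>" "path_image \<gamma> \<subseteq> U" "\<forall>l. pathstart \<gamma> $ l \<in> \<real>"
    and zero: "\<And>x. x \<in> U \<Longrightarrow> \<forall>l. x $ l \<in> \<real> \<Longrightarrow> g x = 0"
  shows "g (pathfinish \<gamma>) = 0"
proof -
  define S where "S = interior {z. g z = 0}"
  \<comment> \<open>A ball in \<open>U\<close> around a point outside \<open>S\<close> is disjoint from \<open>S\<close>, so \<open>T\<close> is an open superset of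
    \<open>U - S\<close> disjoint from \<open>S\<close>.\<close>
  define T where "T = (\<Union>c\<in>U - S. \<Union>r\<in>{r. ball c r \<subseteq> U}. ball c r)"
  have "open S" "open T"
    by (auto simp: S_def T_def)
  have "S \<inter> T = {}"
  proof (rule ccontr)
    assume "S \<inter> T \<noteq> {}"
    then obtain p c r where p: "p \<in> S" "p \<in> ball c r" and c: "c \<notin> S" and r: "ball c r \<subseteq> U"
      by (auto simp: T_def)
    have "g z = 0" if "z \<in> ball c r" for z
    proof (rule left_holomorphic_vanishes_on_ball_if_near_point[OF I _ p(2) \<open>open S\<close> p(1) _ that])
      show "left_holomorphic_on I g (ball c r)"
        using g r by (rule left_holomorphic_on_subset)
      show "g x = 0" if "x \<in> S" for x
        using that interior_subset by (auto simp: S_def)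
    qed
    then have "ball c r \<subseteq> S"
      unfolding S_def by (intro interior_maximal) auto
    moreover have "r > 0"
      using p(2) by (metis ball_eq_empty empty_iff linorder_not_le)
    ultimately show False
      using c centre_in_ball by blast
  qed
  have "U \<subseteq> S \<union> T"
  proof
    fix c assume c: "c \<in> U"
    obtain r where "r > 0" "ball c r \<subseteq> U"
      using U c openE by blast
    then show "c \<in> S \<union> T"
      using c by (cases "c \<in> S") (auto simp: T_def intro!: bexI[of _ c] exI[of _ r])
  qed
  have start: "pathstart \<gamma> \<in> S"
  proof -
    have "pathstart \<gamma> \<in> U"
      using \<gamma> by auto
    then obtain r where r: "r > 0" "ball (pathstart \<gamma>) r \<subseteq> U"
      using U openE by blast
    have "g z = 0" if "z \<in> ball (pathstart \<gamma>) r" for z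
      using left_holomorphic_vanishes_on_ball_if_on_reals[OF I
          left_holomorphic_on_subset[OF g r(2)] \<gamma>(3) _ that] zero r by blast
    then have "ball (pathstart \<gamma>) r \<subseteq> S"
      unfolding S_def by (intro interior_maximal) auto
    then show ?thesis
      using r(1) centre_in_ball by blast
  qed
  have "S \<inter> path_image \<gamma> = {} \<or> T \<inter> path_image \<gamma> = {}"
  proof (rule connectedD[OF _ \<open>open S\<close> \<open>open T\<close>])
    show "connected (path_image \<gamma>)"
      using \<gamma>(1) by (rule connected_path_image)
  qed (use \<open>S \<inter> T = {}\<close> \<open>U \<subseteq> S \<union> T\<close> \<gamma>(2) in auto)
  then have "path_image \<gamma> \<subseteq> S"
    using start \<open>U \<subseteq> S \<union> T\<close> \<gamma>(2) by auto
  then show ?thesis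
    using interior_subset by (auto simp: S_def)
qed

section \<open>Interpolation from two units\<close>

text \<open>The solution \<open>(a, b)\<close> of the linear system \<open>a + J b = p\<close>, \<open>a + K b = q\<close> for \<open>J \<noteq> K\<close>.\<close>

definition stem_snd :: "quat \<Rightarrow> quat \<Rightarrow> quat \<Rightarrow> quat \<Rightarrow> quat" where
  "stem_snd J K p q = inverse (J - K) * (p - q)"

definition stem_fst :: "quat \<Rightarrow> quat \<Rightarrow> quat \<Rightarrow> quat \<Rightarrow> quat" where
  "stem_fst J K p q = p - J * stem_snd J K p q"

lemma stem_interpolates:
  assumes "J \<noteq> K"
  shows "stem_fst J K p q + J * stem_snd J K p q = p"
    and "stem_fst J K p q + K * stem_snd J K p q = q"
proof -
  have "(J - K) * stem_snd J K p q = p - q"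
    using assms by (simp add: stem_snd_def mult.assoc[symmetric])
  then show "stem_fst J K p q + K * stem_snd J K p q = q"
    by (simp add: stem_fst_def algebra_simps)
qed (simp add: stem_fst_def)

lemma affine_in_unit_unique:
  fixes J K :: quat
  assumes "J \<noteq> K" "a + J * b = a' + J * b'" "a + K * b = a' + K * b'"
  shows "a = a'" "b = b'"
proof -
  have "(J - K) * (b - b') = (a + J * b) - (a' + J * b') - ((a + K * b) - (a' + K * b'))"
    by (simp add: algebra_simps)
  then show "b = b'"
    using assms by simp
  then show "a = a'"
    using assms by simp
qed

lemma has_derivative_stem:
  assumes "(p has_derivative P) F" "(q has_derivative Q) F"
  shows "((\<lambda>z. stem_fst J K (p z) (q z)) has_derivative (\<lambda>v. stem_fst J K (P v) (Q v))) F"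
    and "((\<lambda>z. stem_snd J K (p z) (q z)) has_derivative (\<lambda>v. stem_snd J K (P v) (Q v))) F"
  unfolding stem_fst_def stem_snd_def
  by (intro has_derivative_diff has_derivative_mult_right assms)+

text \<open>The transfer principle. Since \<open>I (a + I b) = - b + I a\<close> for every unit \<open>I\<close>, the pairs
  \<open>(D a (\<i>v), D b (\<i>v))\<close> and \<open>(- D b v, D a v)\<close> take the same values at \<open>J\<close> and at \<open>K\<close>, hence
  coincide.\<close>

lemma stem_interpolation_derivative:
  assumes JK: "J \<in> sphere_units" "K \<in> sphere_units" "J \<noteq> K"
    and PQ: "P (\<i> *s v) = J * P v" "Q (\<i> *s v) = K * Q v"
  shows "stem_fst J K (P (\<i> *s v)) (Q (\<i> *s v)) = - stem_snd J K (P v) (Q v)"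
    and "stem_snd J K (P (\<i> *s v)) (Q (\<i> *s v)) = stem_fst J K (P v) (Q v)"
proof -
  let ?a = "stem_fst J K (P v) (Q v)" and ?b = "stem_snd J K (P v) (Q v)"
  have rotate: "I * (?a + I * ?b) = - ?b + I * ?a" if "I \<in> sphere_units" for I
    using unit_square_mult[OF that] by (simp add: distrib_left)
  let ?a' = "stem_fst J K (P (\<i> *s v)) (Q (\<i> *s v))"
  let ?b' = "stem_snd J K (P (\<i> *s v)) (Q (\<i> *s v))"
  have "?a' + J * ?b' = - ?b + J * ?a" "?a' + K * ?b' = - ?b + K * ?a"
    by (simp_all only: rotate[OF JK(1), symmetric] rotate[OF JK(2), symmetric]
        stem_interpolates[OF JK(3)] PQ)
  then show "?a' = - ?b" "?b' = ?a"
    by (fact affine_in_unit_unique[OF JK(3)])+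
qed

lemma left_holomorphic_on_stem_extension:
  assumes I: "I \<in> sphere_units" and JK: "J \<in> sphere_units" "K \<in> sphere_units" "J \<noteq> K"
    and p: "left_holomorphic_on J p U" and q: "left_holomorphic_on K q U"
    and h: "left_holomorphic_on I h U"
  shows "left_holomorphic_on I
    (\<lambda>z. h z - (stem_fst J K (p z) (q z) + I * stem_snd J K (p z) (q z))) U"
  unfolding left_holomorphic_on_def
proof
  fix z assume z: "z \<in> U"
  obtain P where P: "(p has_derivative P) (at z)" "\<And>v. P (\<i> *s v) = J * P v"
    using p z unfolding left_holomorphic_on_def by blast
  obtain Q where Q: "(q has_derivative Q) (at z)" "\<And>v. Q (\<i> *s v) = K * Q v"
    using q z unfolding left_holomorphic_on_def by blast
  obtain H where H: "(h has_derivative H) (at z)" "\<And>v. H (\<i> *s v) = I * H v"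
    using h z unfolding left_holomorphic_on_def by blast
  let ?D = "\<lambda>v. H v - (stem_fst J K (P v) (Q v) + I * stem_snd J K (P v) (Q v))"
  have "((\<lambda>z. h z - (stem_fst J K (p z) (q z) + I * stem_snd J K (p z) (q z)))
      has_derivative ?D) (at z)"
    by (intro has_derivative_diff has_derivative_add has_derivative_mult_right
        has_derivative_stem H P Q)
  moreover have "?D (\<i> *s v) = I * ?D v" for v
    using stem_interpolation_derivative[where P = P and Q = Q, OF JK P(2) Q(2)]
    by (simp add: algebra_simps H(2) unit_square_mult[OF I])
  ultimately show "\<exists>D. ((\<lambda>z. h z - (stem_fst J K (p z) (q z) + I * stem_snd J K (p z) (q z)))
      has_derivative D) (at z) \<and> (\<forall>v. D (\<i> *s v) = I * D v)"
    by blast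
qed

lemma sigma_mat_mult: "sigma_mat *v u = vector [- (u $ 2), u $ 1]"
  by (simp add: vec_eq_iff forall_2 sigma_mat_def matrix_vector_mult_def sum_2)

lemma vector_2_eq_axis: "vector [a, b] = axis 1 a + (axis 2 b :: 'a::comm_monoid_add^2)"
  by (simp add: vec_eq_iff forall_2 axis_def)

lemma has_derivative_vector_2:
  fixes a b :: "'a::real_normed_vector \<Rightarrow> quat"
  assumes "(a has_derivative A) F" "(b has_derivative B) F"
  shows "((\<lambda>z. vector [a z, b z] :: quat^2) has_derivative (\<lambda>v. vector [A v, B v])) F"
proof -
  have "linear (\<lambda>x. axis i x :: quat^2)" for i
    by (rule linearI) (auto simp: vec_eq_iff axis_def)
  then have "bounded_linear (\<lambda>x. axis i x :: quat^2)" for i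
    by (simp add: linear_conv_bounded_linear)
  then show ?thesis
    unfolding vector_2_eq_axis
    by (intro has_derivative_add bounded_linear.has_derivative[OF _ assms(1)]
        bounded_linear.has_derivative[OF _ assms(2)])
qed

lemma cauchy_riemann_at_stem:
  fixes p q :: "complex^'n \<Rightarrow> quat"
  assumes JK: "J \<in> sphere_units" "K \<in> sphere_units" "J \<noteq> K"
    and p: "left_holomorphic_on J p U" and q: "left_holomorphic_on K q U" and z: "z \<in> U"
  shows "cauchy_riemann_at ((*v) sigma_mat)
    (\<lambda>z. vector [stem_fst J K (p z) (q z), stem_snd J K (p z) (q z)]) z"
proof -
  obtain P where P: "(p has_derivative P) (at z)" "\<And>v. P (\<i> *s v) = J * P v"
    using p z unfolding left_holomorphic_on_def by blast
  obtain Q where Q: "(q has_derivative Q) (at z)" "\<And>v. Q (\<i> *s v) = K * Q v"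
    using q z unfolding left_holomorphic_on_def by blast
  let ?D = "\<lambda>v. vector [stem_fst J K (P v) (Q v), stem_snd J K (P v) (Q v)] :: quat^2"
  have D: "((\<lambda>z. vector [stem_fst J K (p z) (q z), stem_snd J K (p z) (q z)] :: quat^2)
      has_derivative ?D) (at z)"
    by (intro has_derivative_vector_2 has_derivative_stem P Q)
  have "?D (axis l 1) + sigma_mat *v ?D (axis l \<i>) = 0" for l
  proof -
    have axis_i: "axis l \<i> = \<i> *s (axis l 1 :: complex^'n)"
      by (auto simp: vec_eq_iff axis_def)
    show ?thesis
      unfolding axis_i
      by (simp add: vec_eq_iff[where 'b = 2] forall_2 sigma_mat_mult
          stem_interpolation_derivative[where P = P and Q = Q, OF JK P(2) Q(2)])
  qed
  then have "(1 / 2) *\<^sub>R (?D (axis l 1) + sigma_mat *v ?D (axis l \<i>)) = 0" for l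
    by simp
  then show ?thesis
    unfolding cauchy_riemann_at_def using has_derivative_imp_partials[OF D] by blast
qed

lemma cauchy_riemann_at_cong_on_open:
  fixes g h :: "complex^'n \<Rightarrow> 'b::real_normed_vector"
  assumes g: "cauchy_riemann_at J g z" and U: "open U" "z \<in> U" and eq: "\<And>w. w \<in> U \<Longrightarrow> g w = h w"
  shows "cauchy_riemann_at J h z"
proof -
  have *: "((\<lambda>t. h (z + axis l (of_real t * c))) has_vector_derivative D) (at 0)"
    if D: "((\<lambda>t. g (z + axis l (of_real t * c))) has_vector_derivative D) (at 0)" for l c D
  proof -
    let ?L = "\<lambda>t::real. z + axis l (of_real t * c)"
    have "continuous_on UNIV ?L"
      unfolding axis_scaleR_real by (intro continuous_intros)
    then have "open (?L -` U)"
      using U(1) open_vimage by blast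
    moreover have "0 \<in> ?L -` U"
      using U(2) unfolding axis_scaleR_real by simp
    ultimately show ?thesis
      using has_vector_derivative_transform_within_open[OF D, of "?L -` U"] eq by simp
  qed
  show ?thesis
    using g *[where c = 1] *[where c = \<i>]
    unfolding cauchy_riemann_at_def has_partial_x_def has_partial_y_def mult_1_right by blast
qed

section \<open>Slice regular functions are path-slice\<close>

lemma linear_lift_point: "linear (lift_point I :: complex^'n \<Rightarrow> quat^'n)"
  by (rule linearI) (auto simp: lift_point_def vec_eq_iff of_real_def algebra_simps)

lemma has_derivative_lift_point:
  "(lift_point I has_derivative lift_point I) (at z within S)" for z :: "complex^'n"
  using linear_lift_point linear_conv_bounded_linear bounded_linear_imp_has_derivative by blast

lemma lift_point_in_slice_space: "lift_point I z \<in> slice_space I"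
  by (auto simp: lift_point_def slice_space_def slice_plane_def)

lemma lift_point_real: "\<forall>l. z $ l \<in> \<real> \<Longrightarrow> lift_point I z = lift_point J z"
  by (auto simp: lift_point_def vec_eq_iff complex_is_Real_iff)

lemma open_vimage_lift_point:
  fixes \<Omega> :: "(quat^'n) set"
  assumes "openin slice_topology \<Omega>" "I \<in> sphere_units"
  shows "open (lift_point I -` \<Omega> :: (complex^'n) set)"
proof -
  obtain T where T: "open T" "\<Omega> \<inter> slice_space I = slice_space I \<inter> T"
    using assms by (auto simp: openin_slice_topology openin_open)
  then have "lift_point I -` \<Omega> = (lift_point I -` T :: (complex^'n) set)"
    using lift_point_in_slice_space by blast
  moreover have "open (lift_point I -` T :: (complex^'n) set)"
    using T(1) has_derivative_continuous[OF has_derivative_lift_point]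
    by (intro continuous_open_vimage)
  ultimately show ?thesis
    by simp
qed

lemma slice_regular_imp_left_holomorphic:
  fixes \<Omega> :: "(quat^'n) set"
  assumes \<Omega>: "openin slice_topology \<Omega>" and f: "slice_regular \<Omega> f" and I: "I \<in> sphere_units"
  shows "left_holomorphic_on I (\<lambda>z. f (lift_point I z)) (lift_point I -` \<Omega>)"
  unfolding left_holomorphic_on_def
proof
  fix z :: "complex^'n" assume z: "z \<in> lift_point I -` \<Omega>"
  let ?U = "lift_point I -` \<Omega> :: (complex^'n) set"
  have U: "open ?U"
    using \<Omega> I by (rule open_vimage_lift_point)
  have "f differentiable (at (lift_point I z) within \<Omega> \<inter> slice_space I)"
    using f I z lift_point_in_slice_space[of I z]
    by (auto simp: slice_regular_def differentiable_on_def)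
  then obtain D where "(f has_derivative D) (at (lift_point I z) within \<Omega> \<inter> slice_space I)"
    by (auto simp: differentiable_def)
  then have "(f has_derivative D) (at (lift_point I z) within lift_point I ` ?U)"
    by (rule has_derivative_subset) (use lift_point_in_slice_space in auto)
  then have "((\<lambda>w. f (lift_point I w)) has_derivative (\<lambda>v. D (lift_point I v))) (at z within ?U)"
    using has_derivative_in_compose[OF has_derivative_lift_point] by blast
  then have D: "((\<lambda>w. f (lift_point I w)) has_derivative (\<lambda>v. D (lift_point I v))) (at z)"
    using at_within_open[OF z U] by simp
  moreover have "cauchy_riemann_at ((*) I) (\<lambda>w. f (lift_point I w)) z"
    using f I z by (auto simp: slice_regular_def)
  ultimately show "\<exists>D. ((\<lambda>w. f (lift_point I w)) has_derivative D) (at z) \<and>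
      (\<forall>v. D (\<i> *s v) = I * D v)"
    using cauchy_riemann_derivative_linear[OF I D] by blast
qed

lemma unit_set_iff: "I \<in> unit_set \<Omega> \<gamma> \<longleftrightarrow> I \<in> sphere_units \<and> path_image \<gamma> \<subseteq> lift_point I -` \<Omega>"
  by (auto simp: unit_set_def path_image_def)

lemma paths_in_iff: "\<gamma> \<in> paths_in \<Omega> \<longleftrightarrow> \<gamma> \<in> real_paths \<and> (\<exists>I. I \<in> unit_set \<Omega> \<gamma>)"
  by (auto simp: paths_in_def)

text \<open>The representation formula: the two values of \<open>f\<close> at the units \<open>J\<close> and \<open>K\<close> determine its
  values at all other units along the path.\<close>

lemma slice_regular_representation:
  fixes \<Omega> :: "(quat^'n) set"
  assumes \<Omega>: "openin slice_topology \<Omega>" and f: "slice_regular \<Omega> f" and \<gamma>: "\<gamma> \<in> real_paths"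
    and I: "I \<in> unit_set \<Omega> \<gamma>" and J: "J \<in> unit_set \<Omega> \<gamma>" and K: "K \<in> unit_set \<Omega> \<gamma>" and "J \<noteq> K"
  defines "p \<equiv> f (lift_point J (pathfinish \<gamma>))" and "q \<equiv> f (lift_point K (pathfinish \<gamma>))"
  shows "f (lift_point I (pathfinish \<gamma>)) = stem_fst J K p q + I * stem_snd J K p q"
proof -
  let ?h = "\<lambda>I z. f (lift_point I z)"
  define U where "U = (\<Inter>L\<in>{I, J, K}. lift_point L -` \<Omega> :: (complex^'n) set)"
  define g where "g = (\<lambda>z. ?h I z -
    (stem_fst J K (?h J z) (?h K z) + I * stem_snd J K (?h J z) (?h K z)))"
  have units: "I \<in> sphere_units" "J \<in> sphere_units" "K \<in> sphere_units"
    using I J K by (auto simp: unit_set_iff)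
  have "open U"
    unfolding U_def using units open_vimage_lift_point[OF \<Omega>] by (intro open_INT) auto
  have hol: "left_holomorphic_on L (?h L) U" if "L \<in> {I, J, K}" for L
  proof (rule left_holomorphic_on_subset)
    show "left_holomorphic_on L (?h L) (lift_point L -` \<Omega>)"
      using that units by (intro slice_regular_imp_left_holomorphic[OF \<Omega> f]) auto
    show "U \<subseteq> lift_point L -` \<Omega>"
      using that by (auto simp: U_def)
  qed
  have "g (pathfinish \<gamma>) = 0"
  proof (rule left_holomorphic_vanishes_along_path[OF units(1) \<open>open U\<close>])
    show "left_holomorphic_on I g U"
      unfolding g_def using hol units \<open>J \<noteq> K\<close> by (intro left_holomorphic_on_stem_extension) auto
    show "path \<gamma>" "\<forall>l. pathstart \<gamma> $ l \<in> \<real>"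
      using \<gamma> by (auto simp: real_paths_def)
    show "path_image \<gamma> \<subseteq> U"
      using I J K by (auto simp: U_def unit_set_iff)
    show "g x = 0" if "\<forall>l. x $ l \<in> \<real>" for x
      using lift_point_real[OF that, of I J] lift_point_real[OF that, of K J]
      by (simp add: g_def stem_fst_def stem_snd_def)
  qed
  then show ?thesis
    by (simp add: g_def p_def q_def)
qed

lemma slice_regular_imp_path_slice:
  fixes \<Omega> :: "(quat^'n) set"
  assumes \<Omega>: "openin slice_topology \<Omega>" and f: "slice_regular \<Omega> f"
  shows "\<exists>F. path_slice_stem \<Omega> f F"
proof -
  have "\<exists>u::quat^2. \<forall>I\<in>unit_set \<Omega> \<gamma>. f (lift_point I (pathfinish \<gamma>)) = u $ 1 + I * u $ 2"
    if \<gamma>: "\<gamma> \<in> paths_in \<Omega>" for \<gamma>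
  proof (cases "\<exists>J\<in>unit_set \<Omega> \<gamma>. \<exists>K\<in>unit_set \<Omega> \<gamma>. J \<noteq> K")
    case True
    then obtain J K where JK: "J \<in> unit_set \<Omega> \<gamma>" "K \<in> unit_set \<Omega> \<gamma>" "J \<noteq> K"
      by blast
    let ?p = "f (lift_point J (pathfinish \<gamma>))" and ?q = "f (lift_point K (pathfinish \<gamma>))"
    show ?thesis
      using slice_regular_representation[OF \<Omega> f _ _ JK] \<gamma>
      by (intro exI[of _ "vector [stem_fst J K ?p ?q, stem_snd J K ?p ?q]"]) (auto simp: paths_in_iff)
  next
    case False
    from \<gamma> obtain J where J: "J \<in> unit_set \<Omega> \<gamma>"
      by (auto simp: paths_in_iff)
    \<comment> \<open>One unit leaves the stem underdetermined; the constant affine map is one choice.\<close>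
    show ?thesis
      using False J by (intro exI[of _ "vector [f (lift_point J (pathfinish \<gamma>)), 0]"]) auto
  qed
  then have "\<exists>F. \<forall>\<gamma>\<in>paths_in \<Omega>. \<forall>I\<in>unit_set \<Omega> \<gamma>.
      f (lift_point I (pathfinish \<gamma>)) = (F \<gamma> :: quat^2) $ 1 + I * F \<gamma> $ 2"
    by (intro bchoice) blast
  then show ?thesis
    by (simp add: path_slice_stem_def)
qed

section \<open>The stem function\<close>

text \<open>Two units pin the stem down. This gives the uniqueness of the stem function as well as an
  explicit formula for it, whose dependence on the end point can be differentiated.\<close>

lemma path_slice_stem_eq:
  assumes G: "path_slice_stem \<Omega> f G" and \<gamma>: "\<gamma> \<in> real_paths"
    and JK: "J \<in> unit_set \<Omega> \<gamma>" "K \<in> unit_set \<Omega> \<gamma>" "J \<noteq> K"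
  defines "p \<equiv> f (lift_point J (pathfinish \<gamma>))" and "q \<equiv> f (lift_point K (pathfinish \<gamma>))"
  shows "G \<gamma> = vector [stem_fst J K p q, stem_snd J K p q]"
proof -
  have "\<gamma> \<in> paths_in \<Omega>"
    using \<gamma> JK(1) by (auto simp: paths_in_iff)
  then have "f (lift_point I (pathfinish \<gamma>)) = G \<gamma> $ 1 + I * G \<gamma> $ 2" if "I \<in> unit_set \<Omega> \<gamma>" for I
    using G that by (simp add: path_slice_stem_def)
  then have "G \<gamma> $ 1 + J * G \<gamma> $ 2 = p" "G \<gamma> $ 1 + K * G \<gamma> $ 2 = q"
    using JK by (simp_all add: p_def q_def)
  then have "G \<gamma> $ 1 = stem_fst J K p q" "G \<gamma> $ 2 = stem_snd J K p q"
    using affine_in_unit_unique[OF JK(3), of "G \<gamma> $ 1" "G \<gamma> $ 2" "stem_fst J K p q" "stem_snd J K p q"]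
    by (simp_all add: stem_interpolates[OF JK(3)])
  then show ?thesis
    by (simp add: vec_eq_iff forall_2)
qed

lemma stem_preserving_two_units:
  assumes "stem_preserving \<Omega>\<^sub>1 \<Omega>\<^sub>2" "\<gamma> \<in> paths_in \<Omega>\<^sub>1"
  obtains J K where "J \<in> unit_set \<Omega>\<^sub>2 \<gamma>" "K \<in> unit_set \<Omega>\<^sub>2 \<gamma>" "J \<noteq> K"
proof -
  have "infinite (unit_set \<Omega>\<^sub>2 \<gamma>) \<or> 2 \<le> card (unit_set \<Omega>\<^sub>2 \<gamma>)"
    using assms by (auto simp: stem_preserving_def)
  then obtain A where "A \<subseteq> unit_set \<Omega>\<^sub>2 \<gamma>" "card A = 2"
    using infinite_arbitrarily_large obtain_subset_with_card_n by metis
  then show ?thesis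
    using that by (auto simp: card_2_iff)
qed

lemma stem_function_eq_restrict:
  assumes \<Omega>: "stem_preserving \<Omega>\<^sub>1 \<Omega>\<^sub>2" and G: "path_slice_stem \<Omega>\<^sub>2 f G"
  shows "stem_function \<Omega>\<^sub>1 \<Omega>\<^sub>2 f = restrict G (paths_in \<Omega>\<^sub>1)"
  unfolding stem_function_def
proof (rule the_equality)
  have "H \<gamma> = G \<gamma>" if H: "path_slice_stem \<Omega>\<^sub>2 f H" and \<gamma>: "\<gamma> \<in> paths_in \<Omega>\<^sub>1" for H \<gamma>
  proof -
    obtain J K where JK: "J \<in> unit_set \<Omega>\<^sub>2 \<gamma>" "K \<in> unit_set \<Omega>\<^sub>2 \<gamma>" "J \<noteq> K"
      using stem_preserving_two_units[OF \<Omega> \<gamma>] .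
    have "\<gamma> \<in> real_paths"
      using \<gamma> by (simp add: paths_in_iff)
    then show ?thesis
      using path_slice_stem_eq[OF H _ JK] path_slice_stem_eq[OF G _ JK] by simp
  qed
  then show "H = restrict G (paths_in \<Omega>\<^sub>1)"
    if "\<exists>H'. path_slice_stem \<Omega>\<^sub>2 f H' \<and> H = restrict H' (paths_in \<Omega>\<^sub>1)" for H
    using that by (auto intro!: restrict_ext)
qed (use G in blast)

lemma path_extend_unit_set:
  fixes \<gamma> :: "real \<Rightarrow> complex^'n"
  assumes \<gamma>: "\<gamma> \<in> real_paths" and z: "z \<in> ball (pathfinish \<gamma>) r"
  shows "path_extend \<gamma> z \<in> real_paths" "pathfinish (path_extend \<gamma> z) = z"
    and "I \<in> unit_set \<Omega> \<gamma> \<Longrightarrow> ball (pathfinish \<gamma>) r \<subseteq> lift_point I -` \<Omega> \<Longrightarrow>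
      I \<in> unit_set \<Omega> (path_extend \<gamma> z)"
proof -
  let ?s = "linepath (pathfinish \<gamma>) z"
  have eq: "path_extend \<gamma> z t = (\<gamma> +++ ?s) t" if "t \<in> {0..1}" for t
    using that by (simp add: path_extend_def)
  have "path \<gamma>" "\<forall>l. pathstart \<gamma> $ l \<in> \<real>"
    using \<gamma> by (auto simp: real_paths_def)
  then have "path (\<gamma> +++ ?s)"
    by simp
  then have "path (path_extend \<gamma> z)"
    unfolding path_def using eq continuous_on_cong by metis
  moreover have "pathstart (path_extend \<gamma> z) = pathstart \<gamma>"
    using eq[of 0] by (simp add: pathstart_def joinpaths_def)
  ultimately show "path_extend \<gamma> z \<in> real_paths"
    using \<open>\<forall>l. pathstart \<gamma> $ l \<in> \<real>\<close> by (simp add: real_paths_def path_extend_def)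
  show "pathfinish (path_extend \<gamma> z) = z"
    using eq[of 1] by (simp add: pathfinish_def joinpaths_def linepath_def)
  assume I: "I \<in> unit_set \<Omega> \<gamma>" and ball: "ball (pathfinish \<gamma>) r \<subseteq> lift_point I -` \<Omega>"
  have "path_image (path_extend \<gamma> z) = path_image (\<gamma> +++ ?s)"
    unfolding path_image_def using eq by (intro image_cong) auto
  also have "\<dots> = path_image \<gamma> \<union> closed_segment (pathfinish \<gamma>) z"
    by (simp add: path_image_join)
  finally have image: "path_image (path_extend \<gamma> z) = \<dots>" .
  have "0 < r"
    using z by (metis ball_eq_empty empty_iff linorder_not_le)
  then have "closed_segment (pathfinish \<gamma>) z \<subseteq> ball (pathfinish \<gamma>) r"
    using z by (intro closed_segment_subset) auto
  then show "I \<in> unit_set \<Omega> (path_extend \<gamma> z)"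
    using I ball by (auto simp: unit_set_iff image)
qed

theorem proposition3p6:
  fixes \<Omega>\<^sub>1 \<Omega>\<^sub>2 :: "(quat^'n) set" and f :: "quat^'n \<Rightarrow> quat"
  assumes "openin slice_topology \<Omega>\<^sub>1"
    and "real_path_connected \<Omega>\<^sub>1"
    and "openin slice_topology \<Omega>\<^sub>2"
    and "stem_preserving \<Omega>\<^sub>1 \<Omega>\<^sub>2"
    and "slice_regular \<Omega>\<^sub>2 f"
  shows "path_holomorphic_on \<Omega>\<^sub>1 (stem_function \<Omega>\<^sub>1 \<Omega>\<^sub>2 f) (paths_in \<Omega>\<^sub>1)"
proof -
  obtain G where G: "path_slice_stem \<Omega>\<^sub>2 f G"
    using slice_regular_imp_path_slice assms by blast
  have stem: "stem_function \<Omega>\<^sub>1 \<Omega>\<^sub>2 f = restrict G (paths_in \<Omega>\<^sub>1)"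
    using assms(4) G by (rule stem_function_eq_restrict)
  have "path_holomorphic_at \<Omega>\<^sub>1 (restrict G (paths_in \<Omega>\<^sub>1)) \<gamma>" if \<gamma>_in: "\<gamma> \<in> paths_in \<Omega>\<^sub>1" for \<gamma>
  proof -
    obtain I where \<gamma>: "\<gamma> \<in> real_paths" and I: "I \<in> unit_set \<Omega>\<^sub>1 \<gamma>"
      using \<gamma>_in by (auto simp: paths_in_iff)
    obtain J K where JK: "J \<in> unit_set \<Omega>\<^sub>2 \<gamma>" "K \<in> unit_set \<Omega>\<^sub>2 \<gamma>" "J \<noteq> K"
      using stem_preserving_two_units[OF assms(4) \<gamma>_in] .
    have units: "I \<in> sphere_units" "J \<in> sphere_units" "K \<in> sphere_units"
      using I JK by (auto simp: unit_set_iff)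
    \<comment> \<open>The segments stay in the first domain along \<open>I\<close> and in the second along \<open>J\<close> and \<open>K\<close>.\<close>
    define U where "U = lift_point I -` \<Omega>\<^sub>1 \<inter> lift_point J -` \<Omega>\<^sub>2 \<inter> (lift_point K -` \<Omega>\<^sub>2 :: (complex^'n) set)"
    have "open U"
      unfolding U_def using units assms(1,3) by (intro open_Int open_vimage_lift_point)
    moreover have "pathfinish \<gamma> \<in> U"
      using I JK pathfinish_in_path_image[of \<gamma>] by (auto simp: U_def unit_set_iff)
    ultimately obtain r where r: "r > 0" "ball (pathfinish \<gamma>) r \<subseteq> U"
      using openE by blast
    let ?B = "ball (pathfinish \<gamma>) r"
    let ?p = "\<lambda>z. f (lift_point J z)" and ?q = "\<lambda>z. f (lift_point K z)"
    have extend: "path_extend \<gamma> z \<in> paths_in \<Omega>\<^sub>1" if "z \<in> ?B" for z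
      using path_extend_unit_set[OF \<gamma> that] I r(2) by (auto simp: U_def paths_in_iff)
    have value_eq: "vector [stem_fst J K (?p z) (?q z), stem_snd J K (?p z) (?q z)] =
        (restrict G (paths_in \<Omega>\<^sub>1) \<circ> path_extend \<gamma>) z" if z: "z \<in> ?B" for z
    proof -
      have "J \<in> unit_set \<Omega>\<^sub>2 (path_extend \<gamma> z)" "K \<in> unit_set \<Omega>\<^sub>2 (path_extend \<gamma> z)"
        using path_extend_unit_set(3)[OF \<gamma> z] JK r(2) by (auto simp: U_def)
      then show ?thesis
        using path_slice_stem_eq[OF G path_extend_unit_set(1)[OF \<gamma> z] _ _ JK(3)]
          path_extend_unit_set(2)[OF \<gamma> z] extend[OF z] by simp
    qed
    have "left_holomorphic_on J ?p ?B" "left_holomorphic_on K ?q ?B"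
      using slice_regular_imp_left_holomorphic[OF assms(3,5)] units r(2)
      by (auto simp: U_def intro: left_holomorphic_on_subset)
    then have "cauchy_riemann_at ((*v) sigma_mat)
        (\<lambda>z. vector [stem_fst J K (?p z) (?q z), stem_snd J K (?p z) (?q z)] :: quat^2) z"
      if "z \<in> ?B" for z
      by (rule cauchy_riemann_at_stem[OF units(2,3) JK(3) _ _ that])
    then have "cauchy_riemann_at ((*v) sigma_mat)
        (restrict G (paths_in \<Omega>\<^sub>1) \<circ> path_extend \<gamma>) z" if "z \<in> ?B" for z
      by (rule cauchy_riemann_at_cong_on_open[OF _ open_ball that value_eq]) (fact that)
    moreover have "path_ball \<gamma> r \<subseteq> paths_in \<Omega>\<^sub>1"
      using extend by (auto simp: path_ball_def)
    ultimately show ?thesis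
      using r(1) unfolding path_holomorphic_at_def by blast
  qed
  then show ?thesis
    by (simp add: path_holomorphic_on_def stem)
qed

end
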